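(* Let $Q=T[H_1,\dots,H_t]$ be a $k$-strong-connected semicomplete composition with $T\notin\mathcal{T}_1$. If $V(H_i)$ induces a connected component of $\overline{U(Q)}$ for some $i\in\{1,\dots,t\}$, then deleting from $Q$ all arcs of $H_i$ (all arcs with both ends in $V(H_i)$) results in a $k$-strong-connected semicomplete composition.
   Context: Digraphs are finite, without loops or parallel arcs (2-cycles are allowed). A digraph is semicomplete if there is at least one arc between every pair of distinct vertices. Let $T$ be a digraph with vertices $u_1,\dots,u_t$ ($t\ge 2$) and let $H_1,\dots,H_t$ be pairwise disjoint nonempty digraphs, where $H_i$ has $n_i$ vertices. The composition $Q=T[H_1,\dots,H_t]$ is the digraph with vertex set $\bigcup_i V(H_i)$ and arc set $\bigcup_{i=1}^t A(H_i)\cup\{xy : x\in V(H_i),\ y\in V(H_p),\ u_iu_p\in A(T)\}$. It is a semicomplete composition if $T$ is semicomplete. A digraph is strong if for every ordered pair of vertices $(x,y)$ there is a directed path from $x$ to $y$ (a one-vertex digraph is strong). $\mathcal{T}_1$ is the set of all semicomplete digraphs $T$ for which there exists a vertex $u$ such that $uv,vu\in A(T)$ for every $v\in V(T)\setminus\{u\}$. $U(D)$ denotes the underlying undirected graph of $D$, and $\overline{G}$ the complement of a graph $G$. A set $S\subseteq V(D)$ is a separator of $D$ if $D-S$ is not strong. A digraph is $k$-strong-connected if every separator has at least $k$ vertices. *)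

theory Defs
  imports "Graph_Theory.Digraph_Component" "HOL-Library.Disjoint_Sets"
begin

text \<open>Finite digraphs without loops and parallel arcs (2-cycles allowed) are those satisfying
  the library predicate \<^const>\<open>pair_digraph\<close>.\<close>

definition semicomplete :: "'b pair_pre_digraph \<Rightarrow> bool" where
  "semicomplete T \<longleftrightarrow> pair_digraph T \<and>
     (\<forall>u\<in>pverts T. \<forall>v\<in>pverts T. u \<noteq> v \<longrightarrow> (u, v) \<in> parcs T \<or> (v, u) \<in> parcs T)"

text \<open>The factors are indexed by the vertices of \<open>T\<close>: \<open>H u\<^sub>i\<close> is the factor substituted
  for \<open>u\<^sub>i\<close>.\<close>

definition composition ::
  "'b pair_pre_digraph \<Rightarrow> ('b \<Rightarrow> 'a pair_pre_digraph) \<Rightarrow> 'a pair_pre_digraph" where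
  "composition T H =
     \<lparr> pverts = (\<Union>u\<in>pverts T. pverts (H u)),
       parcs = (\<Union>u\<in>pverts T. parcs (H u)) \<union>
               {(x, y). \<exists>u v. (u, v) \<in> parcs T \<and> x \<in> pverts (H u) \<and> y \<in> pverts (H v)} \<rparr>"

definition semicomplete_composition ::
  "'b pair_pre_digraph \<Rightarrow> ('b \<Rightarrow> 'a pair_pre_digraph) \<Rightarrow> 'a pair_pre_digraph \<Rightarrow> bool" where
  "semicomplete_composition T H Q \<longleftrightarrow>
     semicomplete T \<and> 2 \<le> card (pverts T) \<and>
     (\<forall>u\<in>pverts T. pair_digraph (H u) \<and> pverts (H u) \<noteq> {}) \<and>
     disjoint_family_on (\<lambda>u. pverts (H u)) (pverts T) \<and>
     Q = composition T H"

definition class_T1 :: "'b pair_pre_digraph set" where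
  "class_T1 = {T. semicomplete T \<and>
     (\<exists>u\<in>pverts T. \<forall>v\<in>pverts T - {u}. (u, v) \<in> parcs T \<and> (v, u) \<in> parcs T)}"

text \<open>Unlike the library's \<^const>\<open>strongly_connected\<close>, which also demands a vertex, this holds
  vacuously for the empty digraph; hence the full vertex set is never a separator.\<close>

definition strong :: "('a, 'c) pre_digraph \<Rightarrow> bool" where
  "strong D \<longleftrightarrow> (\<forall>x\<in>verts D. \<forall>y\<in>verts D. \<exists>p. pre_digraph.apath D x p y)"

definition separator :: "'a pair_pre_digraph \<Rightarrow> 'a set \<Rightarrow> bool" where
  "separator D S \<longleftrightarrow> S \<subseteq> pverts D \<and> \<not> strong (with_proj D \<restriction> (pverts D - S))"

definition k_strong_connected :: "nat \<Rightarrow> 'a pair_pre_digraph \<Rightarrow> bool" where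
  "k_strong_connected k D \<longleftrightarrow> (\<forall>S. separator D S \<longrightarrow> k \<le> card S)"

text \<open>Undirected graphs are represented as symmetric digraphs, so the underlying graph of \<open>D\<close>
  is \<open>mk_symmetric D\<close>.\<close>

definition graph_complement :: "'a pair_pre_digraph \<Rightarrow> 'a pair_pre_digraph" where
  "graph_complement G =
     \<lparr> pverts = pverts G,
       parcs = {(x, y). x \<in> pverts G \<and> y \<in> pverts G \<and> x \<noteq> y \<and> (x, y) \<notin> parcs G} \<rparr>"

definition induces_connected_component :: "'a set \<Rightarrow> 'a pair_pre_digraph \<Rightarrow> bool" where
  "induces_connected_component X G \<longleftrightarrow>
     pre_digraph.max_subgraph (with_proj G) Digraph_Component.connected (with_proj G \<restriction> X)"

definition del_arcs_within :: "'a pair_pre_digraph \<Rightarrow> 'a set \<Rightarrow> 'a pair_pre_digraph" where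
  "del_arcs_within D X = D\<lparr> parcs := parcs D - X \<times> X \<rparr>"

end

theory Submission
  imports Defs
begin

text \<open>Put \<open>X = V(H\<^sub>i)\<close>; all vertices of \<open>X\<close> have the same neighbours outside \<open>X\<close>. If a set \<open>S\<close>
  leaves some vertex outside \<open>X\<close>, then a walk in \<open>Q - S\<close> can be rerouted so as to avoid the arcs
  inside \<open>X\<close>, so \<open>S\<close> separates after the deletion only if it separates \<open>Q\<close>. Otherwise \<open>S\<close>
  contains the complement of \<open>X\<close>. As \<open>T \<notin> \<T>\<^sub>1\<close>, some \<open>H\<^sub>v\<close> receives no arc from \<open>X\<close> or sends no
  arc to \<open>X\<close>; hence the out-neighbourhood or the in-neighbourhood of \<open>X\<close> is a separator of \<open>Q\<close>
  contained in \<open>S\<close>.\<close>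

text \<open>A step inside \<open>X\<close> can be skipped: the walk must leave \<open>X\<close>
  again, as \<open>y\<close> lies outside, and the exit arc is available from every vertex of
  \<open>X\<close>, because all of them have the same out-neighbours outside
  \<open>X\<close>.\<close>

lemma rtrancl_avoid_twins:
  assumes "(x, y) \<in> R\<^sup>*" and "y \<notin> X"
    and out: "\<And>x x' z. x \<in> X \<Longrightarrow> x' \<in> X \<Longrightarrow> z \<notin> X \<Longrightarrow> (x, z) \<in> R \<Longrightarrow> (x', z) \<in> R"
  shows "(x, y) \<in> (R - X \<times> X)\<^sup>*"
  using assms(1)
proof (induction rule: converse_rtrancl_induct)
  case base
  show ?case by simp
next
  case (step x z)
  show ?case
  proof (cases "x \<in> X \<and> z \<in> X")
    case False
    with step.hyps(1) have "(x, z) \<in> R - X \<times> X" by blast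
    with step.IH show ?thesis by (rule converse_rtrancl_into_rtrancl[rotated])
  next
    case True
    \<comment> \<open>The walk supplied by the induction hypothesis is therefore nonempty. Its first
      arc starts in \<open>X\<close> and is not inside \<open>X\<close>, so \<open>w\<close> lies
      outside; \<open>x\<close> then jumps to \<open>w\<close> directly.\<close>
    with \<open>y \<notin> X\<close> have "z \<noteq> y" by blast
    with step.IH obtain w where w: "(z, w) \<in> R - X \<times> X" "(w, y) \<in> (R - X \<times> X)\<^sup>*"
      by (meson converse_rtranclE)
    with True have "(x, w) \<in> R - X \<times> X" using out[of z x w] by blast
    with w(2) show ?thesis by (rule converse_rtrancl_into_rtrancl[rotated])
  qed
qed

text \<open>The vertex \<open>c\<close> outside \<open>X\<close> serves as a relay, so
  \<open>x\<close> and \<open>y\<close> may both lie in \<open>X\<close>. The walk into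
  \<open>c\<close> is rerouted by the previous lemma, the walk out of \<open>c\<close> by the same
  lemma applied to the converse relation.\<close>

lemma rtrancl_delete_within_twins:
  assumes R: "(x, c) \<in> R\<^sup>*" "(c, y) \<in> R\<^sup>*" and c: "c \<notin> X"
    and out: "\<And>x x' z. x \<in> X \<Longrightarrow> x' \<in> X \<Longrightarrow> z \<notin> X \<Longrightarrow> (x, z) \<in> R \<Longrightarrow> (x', z) \<in> R"
    and inn: "\<And>x x' z. x \<in> X \<Longrightarrow> x' \<in> X \<Longrightarrow> z \<notin> X \<Longrightarrow> (z, x) \<in> R \<Longrightarrow> (z, x') \<in> R"
  shows "(x, y) \<in> (R - X \<times> X)\<^sup>*"
proof -
  have "(x, c) \<in> (R - X \<times> X)\<^sup>*"
    using R(1) c out by (rule rtrancl_avoid_twins)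
  moreover have "(y, c) \<in> (R\<inverse> - X \<times> X)\<^sup>*"
  proof (rule rtrancl_avoid_twins)
    show "(y, c) \<in> (R\<inverse>)\<^sup>*" using R(2) by (rule rtrancl_converseI)
  next
    fix x x' z
    assume "x \<in> X" "x' \<in> X" "z \<notin> X" "(x, z) \<in> R\<inverse>"
    then show "(x', z) \<in> R\<inverse>" using inn by blast
  qed (rule c)
  moreover have "R\<inverse> - X \<times> X = (R - X \<times> X)\<inverse>" by blast
  ultimately show ?thesis by (metis rtrancl_converseD rtrancl_trans)
qed

text \<open>Replaces paths in an induced subgraph by the reflexive transitive closure of a plain
  relation, in which walks are easier to reroute.\<close>

lemma strong_induce_subgraph_iff:
  assumes "pair_wf_digraph D" and "A \<subseteq> pverts D"
  shows "strong (with_proj D \<restriction> A) \<longleftrightarrow>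
    (\<forall>x\<in>A. \<forall>y\<in>A. (x, y) \<in> (parcs D \<inter> A \<times> A)\<^sup>*)"
proof -
  interpret pair_wf_digraph D by fact
  interpret I: wf_digraph "with_proj D \<restriction> A"
    by (rule wellformed_induce_subgraph)
  have ends: "arcs_ends (with_proj D \<restriction> A) = parcs D \<inter> A \<times> A"
    by (auto simp: arcs_ends_def arc_to_ends_def)
  \<comment> \<open>The restriction to \<open>x\<close> in \<open>A\<close> matters for the empty
    walk: the closure is reflexive everywhere, reachability only at vertices of the
    subgraph.\<close>
  have "x \<rightarrow>\<^sup>*\<^bsub>with_proj D \<restriction> A\<^esub> y \<longleftrightarrow> (x, y) \<in> (parcs D \<inter> A \<times> A)\<^sup>*"
    if "x \<in> A" for x y
  proof
    assume "x \<rightarrow>\<^sup>*\<^bsub>with_proj D \<restriction> A\<^esub> y"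
    then show "(x, y) \<in> (parcs D \<inter> A \<times> A)\<^sup>*"
      unfolding reachable_def ends by (rule rtrancl_on_rtranclI)
  next
    assume "(x, y) \<in> (parcs D \<inter> A \<times> A)\<^sup>*"
    then show "x \<rightarrow>\<^sup>*\<^bsub>with_proj D \<restriction> A\<^esub> y"
    proof (induction rule: rtrancl_induct)
      case base
      show ?case using that by (simp add: I.reachable_refl)
    next
      case (step y z)
      then show ?case by (metis I.reachable_adj_trans ends)
    qed
  qed
  then show ?thesis
    unfolding strong_def by (simp add: I.reachable_apath)
qed

lemma pair_digraph_composition:
  assumes "semicomplete_composition T H Q"
  shows "pair_digraph Q"
proof -
  have T: "pair_digraph T" and H: "\<And>u. u \<in> pverts T \<Longrightarrow> pair_digraph (H u)"
    and dis: "disjoint_family_on (\<lambda>u. pverts (H u)) (pverts T)" and Q: "Q = composition T H"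
    using assms by (auto simp: semicomplete_composition_def semicomplete_def)
  interpret T: pair_digraph T by fact
  have inT: "u \<in> pverts T" "v \<in> pverts T" "u \<noteq> v" if "(u, v) \<in> parcs T" for u v
    using that T.wellformed T.no_loops by fastforce+
  have inH: "x \<in> pverts (H u)" "y \<in> pverts (H u)" "x \<noteq> y"
    if "u \<in> pverts T" "(x, y) \<in> parcs (H u)" for u x y
  proof -
    interpret pair_digraph "H u" using H that(1) .
    show "x \<in> pverts (H u)" "y \<in> pverts (H u)" "x \<noteq> y"
      using that(2) wellformed no_loops by fastforce+
  qed
  have fin: "finite (pverts Q)"
    using H by (auto simp: Q composition_def pair_digraph_def pair_fin_digraph_def pair_fin_digraph_axioms_def)
  \<comment> \<open>An arc that comes from \<open>T\<close> is no loop, since \<open>T\<close> has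
    no loops and distinct factors are disjoint.\<close>
  have arc: "x \<in> pverts Q \<and> y \<in> pverts Q \<and> x \<noteq> y" if "(x, y) \<in> parcs Q" for x y
    using that inT inH dis unfolding Q composition_def disjoint_family_on_def
    by simp blast
  show ?thesis
  proof
    show "finite (parcs Q)"
      by (rule finite_subset[of _ "pverts Q \<times> pverts Q"]) (use arc fin in auto)
  qed (use arc fin in auto)
qed

text \<open>By disjointness, arcs of the other factors have no end in \<open>H i\<close>, and arcs
  that come from \<open>T\<close> join different factors. So the deletion removes exactly the arcs
  of \<open>H i\<close>, and the factor left there is arcless on the same vertices.\<close>

lemma composition_del_arcs_within:
  assumes "semicomplete_composition T H Q" and "i \<in> pverts T"
  shows "semicomplete_composition T (H(i := (H i)\<lparr>parcs := {}\<rparr>)) (del_arcs_within Q (pverts (H i)))"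
proof -
  have T: "pair_digraph T" and H: "\<And>u. u \<in> pverts T \<Longrightarrow> pair_digraph (H u)"
    and dis: "disjoint_family_on (\<lambda>u. pverts (H u)) (pverts T)" and Q: "Q = composition T H"
    using assms by (auto simp: semicomplete_composition_def semicomplete_def)
  interpret T: pair_digraph T by fact
  let ?H = "H(i := (H i)\<lparr>parcs := {}\<rparr>)"
  have pv: "pverts (?H u) = pverts (H u)" for u by simp
  have inT: "u \<in> pverts T" "v \<in> pverts T" "u \<noteq> v" if "(u, v) \<in> parcs T" for u v
    using that T.wellformed T.no_loops by fastforce+
  have inH: "x \<in> pverts (H u) \<and> y \<in> pverts (H u)"
    if "u \<in> pverts T" "(x, y) \<in> parcs (H u)" for u x y
  proof -
    interpret pair_digraph "H u" using H that(1) .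
    show ?thesis using that(2) wellformed by fastforce
  qed
  have same: "u = v" if "x \<in> pverts (H u)" "x \<in> pverts (H v)" "u \<in> pverts T" "v \<in> pverts T" for x u v
    using dis that by (auto simp: disjoint_family_on_def)
  have "(\<Union>u\<in>pverts T. parcs (?H u)) = (\<Union>u\<in>pverts T. parcs (H u)) - pverts (H i) \<times> pverts (H i)"
  proof (intro equalityI subrelI)
    fix x y
    assume "(x, y) \<in> (\<Union>u\<in>pverts T. parcs (?H u))"
    then obtain u where u: "u \<in> pverts T" "u \<noteq> i" "(x, y) \<in> parcs (H u)"
      by (auto split: if_splits)
    moreover from u have "x \<notin> pverts (H i)" using inH same assms(2) by blast
    ultimately show "(x, y) \<in> (\<Union>u\<in>pverts T. parcs (H u)) - pverts (H i) \<times> pverts (H i)"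
      by blast
  next
    fix x y
    assume "(x, y) \<in> (\<Union>u\<in>pverts T. parcs (H u)) - pverts (H i) \<times> pverts (H i)"
    then obtain u where u: "u \<in> pverts T" "(x, y) \<in> parcs (H u)"
      and "(x, y) \<notin> pverts (H i) \<times> pverts (H i)"
      by blast
    then have "u \<noteq> i" using inH by blast
    with u show "(x, y) \<in> (\<Union>u\<in>pverts T. parcs (?H u))" by auto
  qed
  moreover have "{(x, y). \<exists>u v. (u, v) \<in> parcs T \<and> x \<in> pverts (H u) \<and> y \<in> pverts (H v)} =
    {(x, y). \<exists>u v. (u, v) \<in> parcs T \<and> x \<in> pverts (H u) \<and> y \<in> pverts (H v)}
      - pverts (H i) \<times> pverts (H i)"
    using inT same assms(2) by blast
  ultimately have "composition T ?H = del_arcs_within Q (pverts (H i))"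
    unfolding Q composition_def del_arcs_within_def pv by (simp add: Un_Diff)
  moreover have "pair_digraph (?H u)" if "u \<in> pverts T" for u
  proof (cases "u = i")
    case True
    interpret pair_digraph "H i" using H assms(2) .
    show ?thesis by (unfold_locales) (use True in auto)
  qed (use H that in auto)
  ultimately show ?thesis
    using assms(1) unfolding semicomplete_composition_def pv by simp
qed

text \<open>Across factors, adjacency depends on \<open>T\<close> alone; this makes the vertices of
  one factor twins with respect to everything outside it.\<close>

lemma composition_arc_iff:
  assumes "semicomplete_composition T H Q"
    and u: "u \<in> pverts T" "x \<in> pverts (H u)" and v: "v \<in> pverts T" "y \<in> pverts (H v)"
    and "u \<noteq> v"
  shows "(x, y) \<in> parcs Q \<longleftrightarrow> (u, v) \<in> parcs T"
proof -
  have T: "pair_digraph T" and H: "\<And>u. u \<in> pverts T \<Longrightarrow> pair_digraph (H u)"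
    and dis: "disjoint_family_on (\<lambda>u. pverts (H u)) (pverts T)" and Q: "Q = composition T H"
    using assms by (auto simp: semicomplete_composition_def semicomplete_def)
  interpret T: pair_digraph T by fact
  have inT: "u \<in> pverts T" "v \<in> pverts T" if "(u, v) \<in> parcs T" for u v
    using that T.wellformed by fastforce+
  have same: "u = v" if "x \<in> pverts (H u)" "x \<in> pverts (H v)" "u \<in> pverts T" "v \<in> pverts T" for x u v
    using dis that by (auto simp: disjoint_family_on_def)
  have "(x, y) \<notin> parcs (H w)" if "w \<in> pverts T" for w
  proof
    assume a: "(x, y) \<in> parcs (H w)"
    interpret pair_digraph "H w" using H that .
    have "x \<in> pverts (H w)" "y \<in> pverts (H w)" using a wellformed by fastforce+
    with same that u v \<open>u \<noteq> v\<close> show False by metis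
  qed
  moreover have "u' = u \<and> v' = v"
    if "(u', v') \<in> parcs T" "x \<in> pverts (H u')" "y \<in> pverts (H v')" for u' v'
    using that inT same u v by metis
  ultimately show ?thesis
    using u v unfolding Q composition_def by auto
qed

text \<open>If no arc leads from \<open>X\<close> to \<open>y\<close>, then removing the
  out-neighbours of \<open>X\<close> outside \<open>X\<close> keeps both \<open>x\<close> and
  \<open>y\<close>, but walks from \<open>x\<close> can no longer leave \<open>X\<close>. If no arc
  leads from \<open>y\<close> to \<open>X\<close>, the in-neighbours do the same for walks ending in
  \<open>x\<close>.\<close>

lemma separator_neighbourhood:
  assumes D: "pair_wf_digraph D" and X: "X \<subseteq> pverts D" "x \<in> X" and y: "y \<in> pverts D - X"
    and no_arc: "(\<forall>x\<in>X. (x, y) \<notin> parcs D) \<or> (\<forall>x\<in>X. (y, x) \<notin> parcs D)"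
  shows "\<exists>N \<subseteq> pverts D - X. separator D N"
  using no_arc
proof
  assume no: "\<forall>x\<in>X. (x, y) \<notin> parcs D"
  define N where "N = {z \<in> pverts D - X. \<exists>x\<in>X. (x, z) \<in> parcs D}"
  let ?A = "pverts D - N"
  have "z \<in> X" if "(x, z) \<in> (parcs D \<inter> ?A \<times> ?A)\<^sup>*" for z
    using that by (induction rule: rtrancl_induct) (use X in \<open>auto simp: N_def\<close>)
  moreover have "x \<in> ?A" "y \<in> ?A" "y \<notin> X" using X y no by (auto simp: N_def)
  ultimately have "\<not> strong (with_proj D \<restriction> ?A)"
    by (subst strong_induce_subgraph_iff[OF D]) auto
  then show ?thesis unfolding separator_def by (intro exI[of _ N]) (auto simp: N_def)
next
  assume no: "\<forall>x\<in>X. (y, x) \<notin> parcs D"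
  define N where "N = {z \<in> pverts D - X. \<exists>x\<in>X. (z, x) \<in> parcs D}"
  let ?A = "pverts D - N"
  have "z \<in> X" if "(z, x) \<in> (parcs D \<inter> ?A \<times> ?A)\<^sup>*" for z
    using that by (induction rule: converse_rtrancl_induct) (use X in \<open>auto simp: N_def\<close>)
  moreover have "x \<in> ?A" "y \<in> ?A" "y \<notin> X" using X y no by (auto simp: N_def)
  ultimately have "\<not> strong (with_proj D \<restriction> ?A)"
    by (subst strong_induce_subgraph_iff[OF D]) auto
  then show ?thesis unfolding separator_def by (intro exI[of _ N]) (auto simp: N_def)
qed

theorem theorem2p3:
  fixes T :: "'b pair_pre_digraph"
    and H :: "'b \<Rightarrow> 'a pair_pre_digraph"
    and Q :: "'a pair_pre_digraph"
    and k :: nat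
    and i :: 'b
  assumes "semicomplete_composition T H Q"
    and "k_strong_connected k Q"
    and "T \<notin> class_T1"
    and "i \<in> pverts T"
    and "induces_connected_component (pverts (H i)) (graph_complement (mk_symmetric (with_proj Q)))"
  shows "k_strong_connected k (del_arcs_within Q (pverts (H i))) \<and>
         (\<exists>(T' :: 'b pair_pre_digraph) (H' :: 'b \<Rightarrow> 'a pair_pre_digraph).
            semicomplete_composition T' H' (del_arcs_within Q (pverts (H i))))"
proof -
  let ?X = "pverts (H i)"
  let ?D = "del_arcs_within Q ?X"
  note comp = assms(1)
  have comp': "semicomplete_composition T (H(i := (H i)\<lparr>parcs := {}\<rparr>)) ?D"
    using comp assms(4) by (rule composition_del_arcs_within)
  interpret Q: pair_digraph Q using comp by (rule pair_digraph_composition)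
  interpret D: pair_digraph ?D using comp' by (rule pair_digraph_composition)
  have vD: "pverts ?D = pverts Q" by (simp add: del_arcs_within_def)
  have vQ: "pverts Q = (\<Union>u\<in>pverts T. pverts (H u))"
    using comp by (simp add: semicomplete_composition_def composition_def)
  have dis: "disjoint_family_on (\<lambda>u. pverts (H u)) (pverts T)"
    and ne: "\<And>u. u \<in> pverts T \<Longrightarrow> pverts (H u) \<noteq> {}" and T: "semicomplete T"
    using comp by (auto simp: semicomplete_composition_def)
  have twins: "(x, z) \<in> parcs Q \<longleftrightarrow> (x', z) \<in> parcs Q" "(z, x) \<in> parcs Q \<longleftrightarrow> (z, x') \<in> parcs Q"
    if xs: "x \<in> ?X" "x' \<in> ?X" and z: "z \<in> pverts Q" "z \<notin> ?X" for x x' z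
  proof -
    obtain v where v: "v \<in> pverts T" "z \<in> pverts (H v)" "v \<noteq> i"
      using z vQ by auto
    show "(x, z) \<in> parcs Q \<longleftrightarrow> (x', z) \<in> parcs Q" "(z, x) \<in> parcs Q \<longleftrightarrow> (z, x') \<in> parcs Q"
      using composition_arc_iff[OF comp] xs v assms(4) by metis+
  qed
  have "k \<le> card S" if S: "separator ?D S" for S
  proof (cases "pverts Q - S \<subseteq> ?X")
    case False
    then obtain c where c: "c \<in> pverts Q - S" "c \<notin> ?X" by blast
    let ?A = "pverts Q - S"
    let ?R = "parcs Q \<inter> ?A \<times> ?A"
    have "separator Q S"
    proof (rule ccontr)
      assume "\<not> separator Q S"
      with S have "strong (with_proj Q \<restriction> ?A)" by (simp add: separator_def vD)
      then have conn: "(x, y) \<in> ?R\<^sup>*" if "x \<in> ?A" "y \<in> ?A" for x y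
        using that strong_induce_subgraph_iff[OF Q.pair_wf_digraph_axioms, of ?A] by blast
      have "(x, y) \<in> (parcs ?D \<inter> ?A \<times> ?A)\<^sup>*" if xy: "x \<in> ?A" "y \<in> ?A" for x y
      proof -
        \<comment> \<open>The twin set is cut down to \<open>?X \<inter> ?A\<close>, since removed
          vertices of \<open>?X\<close> have no arcs in \<open>?R\<close> and so are not twins of
          the surviving ones there.\<close>
        have "(x, y) \<in> (?R - (?X \<inter> ?A) \<times> (?X \<inter> ?A))\<^sup>*"
        proof (rule rtrancl_delete_within_twins)
          show "(x, c) \<in> ?R\<^sup>*" "(c, y) \<in> ?R\<^sup>*" using conn xy c by blast+
        qed (use c twins in blast)+
        moreover have "?R - (?X \<inter> ?A) \<times> (?X \<inter> ?A) = parcs ?D \<inter> ?A \<times> ?A"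
          by (auto simp: del_arcs_within_def)
        ultimately show ?thesis by simp
      qed
      then have "strong (with_proj ?D \<restriction> ?A)"
        by (subst strong_induce_subgraph_iff[OF D.pair_wf_digraph_axioms]) (auto simp: vD)
      with S show False by (simp add: separator_def vD)
    qed
    then show ?thesis using assms(2) by (simp add: k_strong_connected_def)
  next
    case True
    \<comment> \<open>As \<open>T\<close> is semicomplete, being outside \<open>class_T1\<close>
      means that no vertex, in particular not \<open>i\<close>, is joined to all others in both
      directions.\<close>
    obtain v where v: "v \<in> pverts T" "v \<noteq> i" and miss: "(i, v) \<notin> parcs T \<or> (v, i) \<notin> parcs T"
      using assms(3,4) T unfolding class_T1_def by blast
    obtain x y where x: "x \<in> ?X" and y: "y \<in> pverts (H v)" using ne v(1) assms(4) by blast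
    have "y \<in> pverts Q - ?X"
      using y v assms(4) dis vQ by (auto simp: disjoint_family_on_def)
    moreover have "?X \<subseteq> pverts Q" using vQ assms(4) by blast
    moreover have "(\<forall>x\<in>?X. (x, y) \<notin> parcs Q) \<or> (\<forall>x\<in>?X. (y, x) \<notin> parcs Q)"
      using miss composition_arc_iff[OF comp] assms(4) v y by metis
    ultimately have "\<exists>N \<subseteq> pverts Q - ?X. separator Q N"
      using separator_neighbourhood[OF Q.pair_wf_digraph_axioms _ x, of y] by metis
    then obtain N where N: "N \<subseteq> pverts Q - ?X" "separator Q N" by blast
    have "S \<subseteq> pverts Q" using S by (simp add: separator_def vD)
    \<comment> \<open>In this case \<open>S\<close> contains every vertex outside \<open>?X\<close>,
      hence all of \<open>N\<close>.\<close>
    then have "card N \<le> card S"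
      using N(1) True by (intro card_mono) (auto intro: finite_subset[OF _ Q.finite_verts])
    moreover have "k \<le> card N" using assms(2) N(2) by (simp add: k_strong_connected_def)
    ultimately show ?thesis by simp
  qed
  then show ?thesis using comp' unfolding k_strong_connected_def by blast
qed

end
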